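(* Let $G$ be a finite group which is either nilpotent or isomorphic to a subgroup of a direct product of (finitely many) groups of square-free order. Then $G$ has the weak EKR property.
   Context: Let a finite group $G$ act transitively on a finite set $X$. A subset $S\subseteq G$ is called intersecting (for this action) if for all $g,h\in S$ there exists $x\in X$ with $g\cdot x=h\cdot x$. The action has the weak EKR property if every intersecting set $S\subseteq G$ satisfies $|S|\le |G|/|X|$ (the cardinality of a point stabilizer). A finite group $G$ has the weak EKR property if every transitive action of $G$ on a finite set has the weak EKR property; equivalently, for every subgroup $H\le G$ the action of $G$ on $G/H$ by left translation, $g\cdot(xH)=(gx)H$, has the weak EKR property. *)

theory Defs
  imports
    Complex_Main
    "HOL-Algebra.Group_Action"
    "HOL-Algebra.Generated_Groups"
    "HOL-Algebra.Product_Groups"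
    "HOL-Computational_Algebra.Squarefree"
begin

definition intersecting ::
    "('a, 'm) monoid_scheme \<Rightarrow> 'x set \<Rightarrow> ('a \<Rightarrow> 'x \<Rightarrow> 'x) \<Rightarrow> 'a set \<Rightarrow> bool"
  where "intersecting G X \<phi> S \<longleftrightarrow>
    S \<subseteq> carrier G \<and> (\<forall>g\<in>S. \<forall>h\<in>S. \<exists>x\<in>X. \<phi> g x = \<phi> h x)"

definition weak_EKR_action ::
    "('a, 'm) monoid_scheme \<Rightarrow> 'x set \<Rightarrow> ('a \<Rightarrow> 'x \<Rightarrow> 'x) \<Rightarrow> bool"
  where "weak_EKR_action G X \<phi> \<longleftrightarrow>
    (\<forall>S. intersecting G X \<phi> S \<longrightarrow> real (card S) \<le> real (order G) / real (card X))"

text \<open>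
  A definition cannot quantify over types, so the type \<open>'x\<close> of the points acted upon is a
  parameter. The property holds for all transitive actions when it is stated with \<open>'x\<close> a free
  type variable, distinct from the type variables of the group.
  The locale \<open>transitive_action\<close> admits the empty set, which is excluded explicitly.
\<close>

definition weak_EKR_group :: "'x itself \<Rightarrow> ('a, 'm) monoid_scheme \<Rightarrow> bool"
  where "weak_EKR_group T G \<longleftrightarrow>
    (\<forall>(X :: 'x set) \<phi>. finite X \<and> X \<noteq> {} \<and> transitive_action G X \<phi>
      \<longrightarrow> weak_EKR_action G X \<phi>)"

primrec lower_central_series :: "('a, 'm) monoid_scheme \<Rightarrow> nat \<Rightarrow> 'a set"
  where
    "lower_central_series G 0 = carrier G"
  | "lower_central_series G (Suc n) =
       generate G {h \<otimes>\<^bsub>G\<^esub> g \<otimes>\<^bsub>G\<^esub> inv\<^bsub>G\<^esub> h \<otimes>\<^bsub>G\<^esub> inv\<^bsub>G\<^esub> g | h g.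
                     h \<in> lower_central_series G n \<and> g \<in> carrier G}"

definition nilpotent_group :: "('a, 'm) monoid_scheme \<Rightarrow> bool"
  where "nilpotent_group G \<longleftrightarrow> group G \<and> (\<exists>n. lower_central_series G n = {\<one>\<^bsub>G\<^esub>})"

end

theory Submission
  imports
    Defs
    "HOL-Algebra.SndIsomorphismGrp"
    "HOL-Algebra.Sylow"
    "HOL-Number_Theory.Number_Theory"
begin

text \<open>
  If \<open>H\<close> is a point stabilizer and \<open>T\<close> is a set of \<open>|G : H|\<close> elements whose quotients \<open>t\<inverse>u\<close>
  (\<open>t \<noteq> u\<close>) lie in no conjugate of \<open>H\<close>, then \<open>(s, t) \<mapsto> s t\<inverse>\<close> is injective on \<open>S \<times> T\<close> for
  every intersecting set \<open>S\<close>, so \<open>|S| \<le> |H|\<close>. Such a \<open>T\<close> can be built along a normal series of \<open>G\<close>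
  all of whose intermediate subgroups are normal: given one for \<open>N H\<close>, multiply it by a transversal
  of \<open>N \<inter> H\<close> in \<open>N\<close>. A nilpotent group has such a series with central factors. A group of
  square-free order has one with factors of prime order, because its elements of order prime to the
  smallest prime divisor \<open>p\<close> form a normal subgroup of index \<open>p\<close> (Burnside's transfer argument);
  these series pull back to subgroups of direct products.
\<close>

section \<open>Sharply transitive sets and the counting bound\<close>

text \<open>The membership in \<open>H\<close> says that \<open>inv t \<otimes> u\<close> fixes the
  coset of \<open>g\<close>, so distinct elements of \<open>T\<close> disagree at every point of
  G/H. Together with |T| = |G : H|, for finite \<open>G\<close> this means that exactly one element
  of \<open>T\<close> takes a given point to a given point.\<close>

definition sharply_transitive_set :: "('a, 'm) monoid_scheme \<Rightarrow> 'a set \<Rightarrow> 'a set \<Rightarrow> bool"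
  where "sharply_transitive_set G H T \<longleftrightarrow>
    T \<subseteq> carrier G \<and> card T * card H = order G \<and>
    (\<forall>t\<in>T. \<forall>u\<in>T. \<forall>g\<in>carrier G.
       inv\<^bsub>G\<^esub> g \<otimes>\<^bsub>G\<^esub> (inv\<^bsub>G\<^esub> t \<otimes>\<^bsub>G\<^esub> u) \<otimes>\<^bsub>G\<^esub> g \<in> H \<longrightarrow> t = u)"

text \<open>The quantifier over all \<open>H\<close> is what carries the induction along a normal
  series: descending below \<open>N\<close> calls for the set that belongs to the product of
  \<open>N\<close> and \<open>H\<close>.\<close>

definition sharp_above :: "('a, 'm) monoid_scheme \<Rightarrow> 'a set \<Rightarrow> bool"
  where "sharp_above G N \<longleftrightarrow>
    (\<forall>H. subgroup H G \<and> N \<subseteq> H \<longrightarrow> (\<exists>T. sharply_transitive_set G H T))"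

text \<open>This is the clique-coclique bound: \<open>S\<close> is a coclique and \<open>T\<close> a
  clique in the Cayley graph whose connection set consists of the elements without fixed
  points.\<close>

lemma (in transitive_action) weak_EKR_action_if_sharply_transitive_set:
  assumes fin: "finite (carrier G)" and x0: "x0 \<in> E"
    and T: "sharply_transitive_set G (stabilizer G \<phi> x0) T"
  shows "weak_EKR_action G E \<phi>"
  unfolding weak_EKR_action_def
proof (intro allI impI)
  fix S assume S: "intersecting G E \<phi> S"
  interpret group G
    using group_hom group_hom.axioms(1) by blast
  let ?H = "stabilizer G \<phi> x0"
  have T_sub: "T \<subseteq> carrier G" and T_card: "card T * card ?H = order G"
    and T_sharp: "\<And>t u g. \<lbrakk>t \<in> T; u \<in> T; g \<in> carrier G; inv g \<otimes> (inv t \<otimes> u) \<otimes> g \<in> ?H\<rbrakk> \<Longrightarrow> t = u"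
    using T unfolding sharply_transitive_set_def by blast+
  have S_sub: "S \<subseteq> carrier G" using S unfolding intersecting_def by blast
  have phi_one: "\<phi> \<one> y = y" if "y \<in> E" for y
    using that by (simp flip: id_eq_one)
  have orbit: "orbit G \<phi> x0 = E"
    unfolding orbit_def using unique_orbit[OF x0] element_image[OF _ x0] by blast
  have EH: "card E * card ?H = order G"
    using orbit_stabilizer_theorem[OF x0] unfolding orbit .
  have pos: "order G > 0" using fin order_gt_0_iff_finite by blast
  have "card T = card E" using T_card EH pos by (metis mult_cancel2 mult_0_right less_numeral_extra(3))
  have "inj_on (\<lambda>(s, t). s \<otimes> inv t) (S \<times> T)"
  proof (rule inj_onI, clarify)
    fix s t s' t' assume st: "s \<in> S" "t \<in> T" "s' \<in> S" "t' \<in> T" and eq: "s \<otimes> inv t = s' \<otimes> inv t'"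
    have c: "s \<in> carrier G" "t \<in> carrier G" "s' \<in> carrier G" "t' \<in> carrier G"
      using st S_sub T_sub by blast+
    \<comment> \<open>A collision equates a quotient of two elements of \<open>T\<close> with a
      quotient of two elements of \<open>S\<close>, which fixes some point \<open>x\<close>. Moving
      \<open>x\<close> back to \<open>x0\<close> by \<open>g\<close> places a conjugate of this
      quotient in \<open>?H\<close>.\<close>
    have e1: "inv s' \<otimes> s = inv t' \<otimes> t"
      using eq c by (metis inv_closed inv_solve_left inv_solve_right m_assoc m_closed)
    obtain x where x: "x \<in> E" "\<phi> s x = \<phi> s' x"
      using S st unfolding intersecting_def by blast
    obtain g where g: "g \<in> carrier G" "\<phi> g x0 = x" using unique_orbit[OF x0 x(1)] by blast
    have "\<phi> (inv s' \<otimes> s) x = \<phi> (inv s') (\<phi> s' x)"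
      unfolding x(2)[symmetric] using c x(1) by (intro composition_rule) auto
    also have "\<dots> = \<phi> (inv s' \<otimes> s') x"
      using c x(1) by (intro composition_rule[symmetric]) auto
    also have "\<dots> = x" using c x(1) phi_one by simp
    finally have fixes_x: "\<phi> (inv s' \<otimes> s) x = x" .
    have "\<phi> (inv g \<otimes> (inv s' \<otimes> s) \<otimes> g) x0 = \<phi> (inv g \<otimes> (inv s' \<otimes> s)) (\<phi> g x0)"
      using c g(1) x0 by (intro composition_rule) auto
    also have "\<dots> = \<phi> (inv g) (\<phi> (inv s' \<otimes> s) x)"
      unfolding g(2) using c g(1) x(1) by (intro composition_rule) auto
    also have "\<dots> = \<phi> (inv g) (\<phi> g x0)" unfolding fixes_x g(2) ..
    also have "\<dots> = \<phi> (inv g \<otimes> g) x0"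
      using c g(1) x0 by (intro composition_rule[symmetric]) auto
    also have "\<dots> = x0" using g(1) x0 phi_one by simp
    finally have "inv g \<otimes> (inv t' \<otimes> t) \<otimes> g \<in> ?H"
      using c g e1 unfolding stabilizer_def by simp
    then have "t' = t" using T_sharp st g by blast
    moreover have "s = s'" using eq c \<open>t' = t\<close> by simp
    ultimately show "s = s' \<and> t = t'" by simp
  qed
  moreover have "(\<lambda>(s, t). s \<otimes> inv t) ` (S \<times> T) \<subseteq> carrier G" using S_sub T_sub by auto
  ultimately have "card (S \<times> T) \<le> card (carrier G)" using fin card_inj_on_le by blast
  then have "card S * card E \<le> order G"
    using \<open>card T = card E\<close> by (simp add: order_def card_cartesian_product)
  then have "real (card S) * real (card E) \<le> real (order G)"
    by (metis of_nat_le_iff of_nat_mult)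
  moreover have "card E > 0" using EH pos by (metis gr0I mult_0 less_numeral_extra(3))
  ultimately show "real (card S) \<le> real (order G) / real (card E)"
    by (simp add: pos_le_divide_eq)
qed

subsection \<open>Building sharply transitive sets along normal series\<close>

context group begin

lemma inv_mult_cancel: "\<lbrakk>x \<in> carrier G; y \<in> carrier G\<rbrakk> \<Longrightarrow> inv x \<otimes> (x \<otimes> y) = y"
  and mult_inv_cancel: "\<lbrakk>x \<in> carrier G; y \<in> carrier G\<rbrakk> \<Longrightarrow> x \<otimes> (inv x \<otimes> y) = y"
  by (simp_all flip: m_assoc)

text \<open>Every point stabilizer contains the identity, so reaching the bottom of a normal series
  settles all transitive actions at once.\<close>

lemma weak_EKR_group_if_sharp_above_one:
  assumes fin: "finite (carrier G)" and "sharp_above G {\<one>}"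
  shows "weak_EKR_group TYPE('x) G"
  unfolding weak_EKR_group_def
proof (intro allI impI, elim conjE)
  fix X :: "'x set" and \<phi> assume tr: "transitive_action G X \<phi>" and "X \<noteq> {}"
  then obtain x where x: "x \<in> X" by blast
  interpret transitive_action G X \<phi> by (fact tr)
  have "subgroup (stabilizer G \<phi> x) G" by (rule stabilizer_subgroup[OF x])
  then obtain T where "sharply_transitive_set G (stabilizer G \<phi> x) T"
    using assms(2) subgroup.one_closed unfolding sharp_above_def by blast
  then show "weak_EKR_action G X \<phi>"
    using weak_EKR_action_if_sharply_transitive_set fin x by blast
qed

lemma sharp_above_carrier: "finite (carrier G) \<Longrightarrow> sharp_above G (carrier G)"
  unfolding sharp_above_def
proof clarify
  fix H assume H: "subgroup H G" "carrier G \<subseteq> H"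
  then have "H = carrier G" using subgroup.subset by blast
  then have "sharply_transitive_set G H {\<one>}"
    unfolding sharply_transitive_set_def by (simp add: order_def)
  then show "\<exists>T. sharply_transitive_set G H T" ..
qed

lemma left_transversal:
  assumes L: "subgroup L G" and N: "subgroup N G" and "L \<subseteq> N"
  obtains U where "U \<subseteq> N" "\<And>n. n \<in> N \<Longrightarrow> \<exists>u\<in>U. \<exists>l\<in>L. n = u \<otimes> l"
    "\<And>u v. \<lbrakk>u \<in> U; v \<in> U; inv u \<otimes> v \<in> L\<rbrakk> \<Longrightarrow> u = v"
proof -
  interpret L: subgroup L G by fact
  interpret N: subgroup N G by fact
  \<comment> \<open>The choice is made from the coset alone, so \<open>r\<close> is constant on
    cosets; hence its image meets each coset once and is fixed pointwise by
    \<open>r\<close>.\<close>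
  define r where "r x = (SOME y. y \<in> x <# L)" for x
  have r_in: "r x \<in> x <# L" if "x \<in> N" for x
  proof -
    have "x \<otimes> \<one> \<in> x <# L" unfolding l_coset_def using L.one_closed by blast
    then show ?thesis unfolding r_def by (rule someI)
  qed
  have rN: "r x \<in> N" if "x \<in> N" for x
    using r_in[OF that] that \<open>L \<subseteq> N\<close> by (auto simp: l_coset_def)
  have coset: "r x <# L = x <# L" if "x \<in> N" for x
    using l_repr_independence[OF r_in[OF that] N.mem_carrier[OF that] L] by simp
  show ?thesis
  proof (rule that[of "r ` N"])
    show "r ` N \<subseteq> N" using rN by blast
  next
    fix n assume n: "n \<in> N"
    then have "n \<in> r n <# L"
      unfolding coset[OF n] using n L.one_closed r_one[OF N.mem_carrier[OF n]] unfolding l_coset_def by force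
    then show "\<exists>u\<in>r ` N. \<exists>l\<in>L. n = u \<otimes> l" using n by (auto simp: l_coset_def)
  next
    fix u v assume u: "u \<in> r ` N" and v: "v \<in> r ` N" and uv: "inv u \<otimes> v \<in> L"
    then have c: "u \<in> N" "v \<in> N" using rN by blast+
    have "v = u \<otimes> (inv u \<otimes> v)" using c by (simp add: m_assoc[symmetric])
    then have "v \<in> u <# L" using uv unfolding l_coset_def by blast
    then have "u <# L = v <# L" using l_repr_independence c L N.mem_carrier by blast
    moreover have "r w = w" if "w \<in> r ` N" for w
      using that coset by (auto simp: r_def)
    ultimately show "u = v" using u v by (metis r_def)
  qed
qed

text \<open>
  The normality hypothesis makes \<open>N \<inter> H\<close> normal, so that a transversal of it in \<open>N\<close> also separates
  all conjugates of \<open>H\<close>.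
\<close>

lemma sharp_above_step:
  assumes fin: "finite (carrier G)" and N: "N \<lhd> G" and sN: "sharp_above G N"
    and M: "subgroup M G" and "M \<subseteq> N"
    and norm: "\<And>L. \<lbrakk>subgroup L G; M \<subseteq> L; L \<subseteq> N\<rbrakk> \<Longrightarrow> L \<lhd> G"
  shows "sharp_above G M"
  unfolding sharp_above_def
proof clarify
  fix H assume H: "subgroup H G" "M \<subseteq> H"
  interpret H: subgroup H G by fact
  interpret N: normal N G by fact
  let ?L = "N \<inter> H"
  have L: "subgroup ?L G" by (intro subgroups_Inter_pair N.subgroup_axioms H)
  interpret L: normal ?L G by (rule norm[OF L]) (use H \<open>M \<subseteq> N\<close> in auto)
  \<comment> \<open>\<open>H\<close> need not contain \<open>N\<close>, but this product does, so
    the hypothesis on \<open>N\<close> supplies \<open>T\<close> for it.\<close>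
  define K where "K = N <#> H"
  interpret second_isomorphism_grp N G H
    by (simp add: second_isomorphism_grp_def second_isomorphism_grp_axioms_def N H)
  have K: "subgroup K G" unfolding K_def by (rule normal_set_mult_subgroup)
  interpret K: subgroup K G by fact
  have NK: "N \<subseteq> K" 
  proof
    fix x assume "x \<in> N"
    then have "x = x \<otimes> \<one>" by simp
    then show "x \<in> K" using \<open>x \<in> N\<close> H.one_closed unfolding K_def set_mult_def by blast
  qed
  have HK: "H \<subseteq> K"
  proof
    fix x assume "x \<in> H"
    then have "x = \<one> \<otimes> x" by simp
    then show "x \<in> K" using \<open>x \<in> H\<close> N.one_closed unfolding K_def set_mult_def by blast
  qed
  obtain T where T: "T \<subseteq> carrier G" "card T * card K = order G"
    and T_sharp: "\<And>t u g. \<lbrakk>t \<in> T; u \<in> T; g \<in> carrier G; inv g \<otimes> (inv t \<otimes> u) \<otimes> g \<in> K\<rbrakk> \<Longrightarrow> t = u"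
    using sN K NK unfolding sharp_above_def sharply_transitive_set_def by meson
  obtain U where U: "U \<subseteq> N" and U_cover: "\<And>n. n \<in> N \<Longrightarrow> \<exists>u\<in>U. \<exists>l\<in>?L. n = u \<otimes> l"
    and U_inj: "\<And>u v. \<lbrakk>u \<in> U; v \<in> U; inv u \<otimes> v \<in> ?L\<rbrakk> \<Longrightarrow> u = v"
    using left_transversal[OF L N.subgroup_axioms] by blast
  have Uc: "u \<in> carrier G" if "u \<in> U" for u using U that N.subset by blast
  have Tc: "u \<in> carrier G" if "u \<in> T" for u using T that by blast
  have bij: "bij_betw (\<lambda>(u, h). u \<otimes> h) (U \<times> H) K"
    unfolding bij_betw_def
  proof (intro conjI subset_antisym)
    show "inj_on (\<lambda>(u, h). u \<otimes> h) (U \<times> H)"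
    proof (rule inj_onI, clarify)
      fix u h v k assume *: "u \<in> U" "h \<in> H" "v \<in> U" "k \<in> H" "u \<otimes> h = v \<otimes> k"
      then have c: "u \<in> carrier G" "h \<in> carrier G" "v \<in> carrier G" "k \<in> carrier G" 
        using Uc by auto
      have "inv u \<otimes> v = h \<otimes> inv k" 
        using c *(5) by (metis inv_closed inv_solve_left inv_solve_right m_assoc m_closed)
      moreover have "inv u \<otimes> v \<in> N" using * U by auto
      ultimately have "inv u \<otimes> v \<in> ?L" using * by auto
      then have "u = v" using U_inj * by blast
      then show "u = v \<and> h = k" using * c by simp
    qed
    show "(\<lambda>(u, h). u \<otimes> h) ` (U \<times> H) \<subseteq> K" using U unfolding K_def set_mult_def by auto
    show "K \<subseteq> (\<lambda>(u, h). u \<otimes> h) ` (U \<times> H)"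
    proof
      fix x assume "x \<in> K"
      then obtain n h where x: "n \<in> N" "h \<in> H" "x = n \<otimes> h" unfolding K_def set_mult_def by auto
      obtain u l where u: "u \<in> U" "l \<in> ?L" "n = u \<otimes> l" using U_cover x by blast
      have "x = u \<otimes> (l \<otimes> h)" "l \<otimes> h \<in> H" using x u Uc by (auto simp: m_assoc)
      then show "x \<in> (\<lambda>(u, h). u \<otimes> h) ` (U \<times> H)" using u by force
    qed
  qed
  then have cK: "card U * card H = card K"
    using bij_betw_same_card[OF bij] by (simp add: card_cartesian_product)
  have sharp: "t = t' \<and> u = u'"
    if *: "t \<in> T" "t' \<in> T" "u \<in> U" "u' \<in> U" "g \<in> carrier G"
      "inv g \<otimes> (inv (t \<otimes> u) \<otimes> (t' \<otimes> u')) \<otimes> g \<in> H" for t t' u u' g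
  proof -
    have c: "u \<in> carrier G" "u' \<in> carrier G" "t \<in> carrier G" "t' \<in> carrier G" 
      using * Uc Tc by auto
    have uN: "inv g \<otimes> u \<otimes> g \<in> N" "inv g \<otimes> inv u' \<otimes> g \<in> N"
      using * U by (auto intro!: N.inv_op_closed1)
    \<comment> \<open>Conjugates of elements of \<open>U\<close> stay in \<open>N\<close>, hence in
      \<open>K\<close>. Multiplying by them strips off \<open>u\<close> and \<open>u'\<close>, which
      leaves a conjugate of \<open>inv t \<otimes> t'\<close> in \<open>K\<close>.\<close>
    have "(inv g \<otimes> u \<otimes> g) \<otimes> (inv g \<otimes> (inv (t \<otimes> u) \<otimes> (t' \<otimes> u')) \<otimes> g) \<otimes> (inv g \<otimes> inv u' \<otimes> g) \<in> K"
      using uN NK HK *(6) by (meson K.m_closed subsetD)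
    also have "(inv g \<otimes> u \<otimes> g) \<otimes> (inv g \<otimes> (inv (t \<otimes> u) \<otimes> (t' \<otimes> u')) \<otimes> g) \<otimes> (inv g \<otimes> inv u' \<otimes> g)
      = inv g \<otimes> (inv t \<otimes> t') \<otimes> g"
      using c *(5) by (simp add: m_assoc inv_mult_group mult_inv_cancel)
    finally have t: "t = t'" using T_sharp * by blast
    have "inv (t \<otimes> u) \<otimes> (t' \<otimes> u') = inv u \<otimes> u'"
      using c t by (simp add: m_assoc inv_mult_group inv_mult_cancel)
    then have "inv g \<otimes> (inv u \<otimes> u') \<otimes> g \<in> H" using *(6) by simp
    moreover have uN': "inv u \<otimes> u' \<in> N" using * U by auto
    ultimately have "inv g \<otimes> (inv u \<otimes> u') \<otimes> g \<in> ?L" using N.inv_op_closed1 *(5) by blast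
    then have "g \<otimes> (inv g \<otimes> (inv u \<otimes> u') \<otimes> g) \<otimes> inv g \<in> ?L" using L.inv_op_closed2 *(5) by blast
    also have "g \<otimes> (inv g \<otimes> (inv u \<otimes> u') \<otimes> g) \<otimes> inv g = inv u \<otimes> u'"
      using c *(5) by (simp add: m_assoc mult_inv_cancel)
    finally show ?thesis using U_inj * t by blast
  qed
  let ?V = "(\<lambda>(t, u). t \<otimes> u) ` (T \<times> U)"
  have "inj_on (\<lambda>(t, u). t \<otimes> u) (T \<times> U)"
  proof (rule inj_onI, clarify)
    fix t u t' u' assume *: "t \<in> T" "t' \<in> T" "u \<in> U" "u' \<in> U" "t \<otimes> u = t' \<otimes> u'"
    have "inv \<one> \<otimes> (inv (t \<otimes> u) \<otimes> (t' \<otimes> u')) \<otimes> \<one> \<in> H" 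
      using * Uc Tc by (simp flip: *(5))
    then show "t = t' \<and> u = u'" using sharp * by blast
  qed
  then have "card ?V = card T * card U" by (simp add: card_image card_cartesian_product)
  then have "card ?V * card H = order G" using T(2) cK by (simp add: mult.assoc)
  moreover have "?V \<subseteq> carrier G" using Uc Tc by auto
  moreover have "\<forall>x\<in>?V. \<forall>y\<in>?V. \<forall>g\<in>carrier G. inv g \<otimes> (inv x \<otimes> y) \<otimes> g \<in> H \<longrightarrow> x = y"
    using sharp by fast
  ultimately show "\<exists>T. sharply_transitive_set G H T" unfolding sharply_transitive_set_def by blast
qed

section \<open>The lower central series\<close>

lemma subgroup_conj_inv_in:
  assumes "subgroup M G" "h \<in> carrier G" "g \<in> carrier G" "h \<otimes> g \<otimes> inv h \<otimes> inv g \<in> M"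
  shows "g \<otimes> h \<otimes> inv g \<otimes> inv h \<in> M"
proof -
  have "inv (h \<otimes> g \<otimes> inv h \<otimes> inv g) = g \<otimes> h \<otimes> inv g \<otimes> inv h"
    using assms by (simp add: inv_mult_group m_assoc)
  then show ?thesis using assms subgroup.m_inv_closed by metis
qed

text \<open>Consecutive terms have a central factor, so every \<open>L\<close> between them is
  normal: a conjugate of \<open>l\<close> is a commutator from the smaller term times
  \<open>l\<close>. This is what \<open>sharp_above_step\<close> asks for.\<close>

lemma lower_central_series_normal_sharp_above:
  assumes fin: "finite (carrier G)"
  shows "lower_central_series G n \<lhd> G \<and> sharp_above G (lower_central_series G n)"
proof (induction n)
  case 0
  have "carrier G \<lhd> G" by (rule normal_invI[OF subgroup_self]) auto
  then show ?case using sharp_above_carrier[OF fin] by simp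
next
  case (Suc n)
  let ?N = "lower_central_series G n" and ?M = "lower_central_series G (Suc n)"
  let ?C = "{h \<otimes> g \<otimes> inv h \<otimes> inv g | h g. h \<in> ?N \<and> g \<in> carrier G}"
  interpret N: normal ?N G using Suc by blast
  have CN: "?C \<subseteq> ?N"
  proof clarify
    fix h g assume "h \<in> ?N" "g \<in> carrier G"
    moreover from this have "g \<otimes> inv h \<otimes> inv g \<in> ?N" by (intro N.inv_op_closed2) auto
    ultimately show "h \<otimes> g \<otimes> inv h \<otimes> inv g \<in> ?N" 
      using N.m_closed by (metis N.mem_carrier inv_closed m_assoc m_closed)
  qed
  have M: "subgroup ?M G" using CN N.subset by (simp add: generate_is_subgroup)
  have MN: "?M \<subseteq> ?N" using generate_subgroup_incl[OF CN N.subgroup_axioms] by simp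
  have norm: "L \<lhd> G" if L: "subgroup L G" "?M \<subseteq> L" "L \<subseteq> ?N" for L
  proof (rule normal_invI[OF L(1)])
    interpret L: subgroup L G by fact
    fix g l assume gl: "g \<in> carrier G" "l \<in> L"
    then have "l \<in> ?N" using L by blast
    then have "l \<otimes> g \<otimes> inv l \<otimes> inv g \<in> ?M" using gl by (auto intro!: generate.incl)
    \<comment> \<open>The series is generated by commutators with its own element first; the inverse
      commutator is the one that expresses the conjugate of \<open>l\<close> by
      \<open>g\<close>.\<close>
    then have "g \<otimes> l \<otimes> inv g \<otimes> inv l \<in> L" 
      using subgroup_conj_inv_in[OF M] gl L by auto
    then have "g \<otimes> l \<otimes> inv g \<otimes> inv l \<otimes> l \<in> L" using gl by blast
    then show "g \<otimes> l \<otimes> inv g \<in> L" using gl by (simp add: m_assoc)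
  qed
  have "sharp_above G ?M"
    by (rule sharp_above_step[OF fin N.normal_axioms conjunct2[OF Suc] M MN norm])
  moreover have "?M \<lhd> G" by (rule norm[OF M order_refl MN])
  ultimately show ?case by blast
qed

end

subsection \<open>Transfer into a subgroup of prime order\<close>

text \<open>The multiplicative order \<open>ord p k\<close> divides \<open>p - 1\<close> by Fermat's
  theorem and \<open>p * m\<close> by hypothesis. These two numbers are coprime, so the order is
  1.\<close>

lemma cong_1_if_power_cong_1:
  fixes k :: nat
  assumes p: "prime p" and "m > 0" and cop: "coprime (p - 1) m" and k: "[k ^ (p * m) = 1] (mod p)"
  shows "[k = 1] (mod p)"
proof -
  have "\<not> p dvd k"
  proof
    assume "p dvd k"
    moreover have "k dvd k ^ (p * m)" using \<open>m > 0\<close> prime_gt_0_nat[OF p] by (intro dvd_power) auto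
    ultimately have "p dvd 1" using k by (metis cong_dvd_iff dvd_trans)
    then show False using p by auto
  qed
  then have "[k ^ (p - 1) = 1] (mod p)" by (rule fermat_theorem[OF p])
  then have "ord p k dvd p - 1" "ord p k dvd p * m" using k by (simp_all only: ord_divides)
  moreover have "coprime (p - 1) (p * m)"
    using cop coprime_diff_one_left_nat[OF prime_gt_0_nat[OF p]] by simp
  ultimately have "ord p k = 1" by (metis coprime_common_divisor_nat nat_dvd_1_iff_1 )
  then have "[k ^ 1 = 1] (mod p)" by (simp only: ord_divides dvd_refl)
  then show ?thesis by simp
qed

text \<open>The powers of \<open>z\<close> form a Sylow subgroup of order \<open>p\<close>. The
  condition on \<open>p - 1\<close> forces every element normalizing it to centralize it, which is
  the situation of Burnside's transfer theorem.\<close>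

locale prime_order_element = group G for G (structure) +
  fixes z :: 'a and p m :: nat
  assumes p: "prime p" and order: "order G = p * m"
    and p_m: "coprime p m" and p1_m: "coprime (p - 1) m"
    and z [simp]: "z \<in> carrier G" and ord_z: "ord z = p"
begin

lemma m_pos: "m > 0"
  using p_m p by (intro Nat.gr0I) auto

lemma finite_carrier: "finite (carrier G)"
  using order m_pos p prime_gt_0_nat order_gt_0_iff_finite by simp

lemma z_pow_eq_iff: "z [^] (i::int) = z [^] (j::int) \<longleftrightarrow> [i = j] (mod int p)"
  by (metis int_pow_eq z ord_z cong_iff_dvd_diff cong_sym_eq)

lemma z_pow_nat: obtains k :: nat where "z [^] (i::int) = z [^] k"
proof
  have "z [^] i = z [^] int (nat (i mod int p))"
    using prime_gt_0_nat[OF p] by (simp add: z_pow_eq_iff)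
  then show "z [^] i = z [^] nat (i mod int p)" by (simp add: int_pow_int)
qed

text \<open>Conjugation by \<open>x\<close> acts on the powers of \<open>z\<close> by raising them
  to the power \<open>k\<close>. Repeating it |G| times gives the identity map, so
  \<open>k ^ (p * m)\<close> is 1 modulo \<open>p\<close>, and then so is \<open>k\<close>.\<close>

lemma commute_if_normalizes:
  fixes k :: nat
  assumes x: "x \<in> carrier G" and xz: "x \<otimes> z = z [^] k \<otimes> x"
  shows "x \<otimes> z = z \<otimes> x"
proof -
  have 1: "x \<otimes> z [^] j = z [^] (k * j) \<otimes> x" for j :: nat
  proof (induction j)
    case (Suc j)
    have "x \<otimes> z [^] Suc j = z [^] (k * j) \<otimes> (x \<otimes> z)"
      using x Suc by (simp flip: m_assoc)
    also have "\<dots> = z [^] (k * j + k) \<otimes> x" using x xz by (simp add: nat_pow_mult flip: m_assoc)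
    finally show ?case by (simp add: add.commute)
  qed (use x in simp)
  have 2: "x [^] n \<otimes> z = z [^] (k ^ n) \<otimes> x [^] n" for n :: nat
  proof (induction n)
    case (Suc n)
    have Suc2: "x [^] Suc n = x \<otimes> x [^] n" using x by (rule nat_pow_Suc2)
    have "x [^] Suc n \<otimes> z = x \<otimes> (x [^] n \<otimes> z)" unfolding Suc2 using x by (simp add: m_assoc)
    also have "\<dots> = (x \<otimes> z [^] (k ^ n)) \<otimes> x [^] n" using x Suc by (simp add: m_assoc)
    also have "\<dots> = z [^] (k * k ^ n) \<otimes> (x \<otimes> x [^] n)" using x 1 by (simp add: m_assoc)
    finally show ?case unfolding Suc2 by simp
  qed simp
  have "z = z [^] (k ^ order G)" using 2[of "order G"] x by (simp add: pow_order_eq_1)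
  then have "z [^] int 1 = z [^] int (k ^ order G)" by (simp only: int_pow_int nat_pow_eone z)
  then have "[k ^ (p * m) = 1] (mod p)"
    unfolding z_pow_eq_iff order by (metis cong_int_iff cong_sym)
  then have "[k = 1] (mod p)" by (rule cong_1_if_power_cong_1[OF p m_pos p1_m])
  then have "z [^] int k = z [^] int 1" unfolding z_pow_eq_iff by (metis cong_int_iff)
  then show ?thesis using xz by (simp only: int_pow_int nat_pow_eone z)
qed

text \<open>\<open>z [^] b\<close> generates the same subgroup as \<open>z\<close>; inverting
  \<open>b\<close> modulo \<open>p\<close> reduces the claim to
  \<open>commute_if_normalizes\<close>.\<close>

lemma commute_if_pow_normalizes:
  fixes a b :: int
  assumes x: "x \<in> carrier G" and xz: "x \<otimes> z [^] b = z [^] a \<otimes> x" and b: "\<not> int p dvd b"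
  shows "x \<otimes> z = z \<otimes> x"
proof -
  have 1: "x \<otimes> z [^] (b * int n) = z [^] (a * int n) \<otimes> x" for n :: nat
  proof (induction n)
    case (Suc n)
    have b: "b * int (Suc n) = b * int n + b" and a: "a * int (Suc n) = a * int n + a"
      by (simp_all add: algebra_simps)
    have "x \<otimes> z [^] (b * int (Suc n)) = (x \<otimes> z [^] (b * int n)) \<otimes> z [^] b"
      unfolding b using x by (simp add: m_assoc int_pow_mult)
    also have "\<dots> = z [^] (a * int n) \<otimes> (x \<otimes> z [^] b)" using Suc x by (simp add: m_assoc)
    also have "\<dots> = z [^] (a * int n + a) \<otimes> x" using xz x by (simp add: int_pow_mult m_assoc)
    finally show ?case unfolding a .
  qed (use x in simp)
  have "coprime b (int p)" using b p by (metis coprime_commute prime_imp_coprime prime_nat_int_transfer)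
  then obtain c where c: "[b * c = 1] (mod int p)" using cong_solve_coprime_int by blast
  define n where "n = nat (c mod int p)"
  have "[int n = c] (mod int p)" using prime_gt_0_nat[OF p] unfolding n_def by (simp add: cong_def)
  then have "[b * int n = 1] (mod int p)" using c by (meson cong_scalar_left cong_trans)
  then have "z [^] (b * int n) = z [^] (1 :: int)" by (simp only: z_pow_eq_iff)
  moreover obtain k :: nat where "z [^] (a * int n) = z [^] k" by (rule z_pow_nat)
  ultimately have "x \<otimes> z = z [^] k \<otimes> x" using 1[of n] by simp
  then show ?thesis by (rule commute_if_normalizes[OF x])
qed

lemma commute_pow: 
  assumes "x \<in> carrier G" "x \<otimes> z = z \<otimes> x" 
  shows "x \<otimes> z [^] (i :: int) = z [^] i \<otimes> x"
proof -
  obtain k :: nat where k: "z [^] i = z [^] k" by (rule z_pow_nat)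
  have "x \<otimes> z [^] k = z [^] k \<otimes> x" for k :: nat
  proof (induction k)
    case (Suc k)
    have "x \<otimes> z [^] Suc k = z [^] k \<otimes> (x \<otimes> z)" using Suc assms(1) by (simp flip: m_assoc)
    then show ?case using assms by (simp add: m_assoc)
  qed (use assms in simp)
  then show ?thesis by (simp add: k)
qed

text \<open>Powers of \<open>z\<close> commute with \<open>z\<close> and cancel, so whether an
  element centralizes \<open>z\<close> depends only on its double coset.\<close>

lemma commute_pow_mult_iff:
  assumes "x \<in> carrier G"
  shows "z [^] (i::int) \<otimes> x \<otimes> z [^] (j::int) \<otimes> z = z \<otimes> (z [^] i \<otimes> x \<otimes> z [^] j) \<longleftrightarrow> x \<otimes> z = z \<otimes> x"
proof -
  have zz: "z [^] k \<otimes> z = z \<otimes> z [^] k" for k :: int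
    using commute_pow[OF z] by simp
  have "z [^] i \<otimes> x \<otimes> z [^] j \<otimes> z = z [^] i \<otimes> (x \<otimes> z) \<otimes> z [^] j"
    using assms by (simp add: m_assoc zz)
  moreover have "z \<otimes> (z [^] i \<otimes> x \<otimes> z [^] j) = z [^] i \<otimes> (z \<otimes> x) \<otimes> z [^] j"
    using assms by (simp flip: m_assoc zz)
  ultimately show ?thesis using assms by simp
qed

text \<open>
  The zeros of \<open>c\<close> modulo \<open>p\<close> are a transversal of the cosets of \<open>\<langle>z\<rangle>\<close>. Taking representatives of
  double cosets makes the part outside the centralizer of \<open>z\<close> stable under left multiplication by
  \<open>z\<close>, so that only the centralizer contributes to the transfer of \<open>z\<close>.
\<close>

lemma coset_coordinate:
  obtains c :: "'a \<Rightarrow> int" where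
    "\<And>x j. x \<in> carrier G \<Longrightarrow> [c (x \<otimes> z [^] j) = c x + j] (mod int p)"
    "\<And>x. \<lbrakk>x \<in> carrier G; x \<otimes> z \<noteq> z \<otimes> x\<rbrakk> \<Longrightarrow> [c (z \<otimes> x) = c x] (mod int p)"
proof -
  \<comment> \<open>\<open>D x\<close> is the double coset of \<open>x\<close> by the powers of
    \<open>z\<close>. The representative \<open>d x\<close> is chosen from this set, so all its
    elements share it.\<close>
  define D where "D x = {z [^] i \<otimes> x \<otimes> z [^] j | (i :: int) (j :: int). True}" for x
  define d where "d x = (SOME y. y \<in> D x)" for x
  have D_sub: "D (z [^] i \<otimes> x \<otimes> z [^] j) \<subseteq> D x" if x: "x \<in> carrier G" for x and i j :: int
  proof
    fix y assume "y \<in> D (z [^] i \<otimes> x \<otimes> z [^] j)"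
    then obtain a b :: int where "y = z [^] a \<otimes> (z [^] i \<otimes> x \<otimes> z [^] j) \<otimes> z [^] b"
      unfolding D_def by auto
    also have "\<dots> = z [^] (a + i) \<otimes> x \<otimes> z [^] (j + b)"
      using x by (simp add: m_assoc int_pow_mult)
    finally show "y \<in> D x" unfolding D_def by blast
  qed
  have undo: "x = z [^] (- i) \<otimes> (z [^] i \<otimes> x \<otimes> z [^] j) \<otimes> z [^] (- j)"
    if x: "x \<in> carrier G" for x and i j :: int
  proof -
    have "z [^] (- i) \<otimes> (z [^] i \<otimes> x \<otimes> z [^] j) \<otimes> z [^] (- j) 
      = (z [^] (- i) \<otimes> z [^] i) \<otimes> x \<otimes> (z [^] j \<otimes> z [^] (- j))"
      using x by (simp add: m_assoc)
    also have "\<dots> = x" using x by (simp flip: int_pow_mult)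
    finally show ?thesis by simp
  qed
  have D_eq: "D (z [^] i \<otimes> x \<otimes> z [^] j) = D x" if x: "x \<in> carrier G" for x and i j :: int
  proof
    show "D x \<subseteq> D (z [^] i \<otimes> x \<otimes> z [^] j)"
      using D_sub[of "z [^] i \<otimes> x \<otimes> z [^] j" "- i" "- j"] undo[OF x, of i j] x by simp
  qed (rule D_sub[OF x])
  have d_eq: "d (z [^] i \<otimes> x \<otimes> z [^] j) = d x" if "x \<in> carrier G" for x and i j :: int
    unfolding d_def D_eq[OF that] ..
  have d_in: "d x \<in> D x" if "x \<in> carrier G" for x
    unfolding d_def by (rule someI[of _ "z [^] (0::int) \<otimes> x \<otimes> z [^] (0::int)"]) (unfold D_def, blast)
  have dc: "d x \<in> carrier G" if "x \<in> carrier G" for x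
    using d_in[OF that] that by (auto simp: D_def)
  \<comment> \<open>\<open>j\<close> will be the coordinate of \<open>x\<close>. When
    \<open>x\<close> centralizes \<open>z\<close>, the two exponents can be traded against each
    other, and \<open>i = 0\<close> is what makes \<open>j\<close> unique modulo \<open>p\<close>.
    Otherwise \<open>j\<close> is unique by itself.\<close>
  define W where "W x i j \<longleftrightarrow> x = z [^] i \<otimes> d x \<otimes> z [^] j \<and> (x \<otimes> z = z \<otimes> x \<longrightarrow> i = 0)"
    for x and i j :: int
  have W_ex: "\<exists>j i. W x i j" if x: "x \<in> carrier G" for x
  proof -
    obtain i j :: int where ij: "d x = z [^] i \<otimes> x \<otimes> z [^] j" using d_in[OF x] unfolding D_def by blast
    have x_eq: "x = z [^] (- i) \<otimes> d x \<otimes> z [^] (- j)" using undo[OF x] unfolding ij .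
    show ?thesis
    proof (cases "x \<otimes> z = z \<otimes> x")
      case True
      then have "d x \<otimes> z = z \<otimes> d x" using commute_pow_mult_iff[OF x] unfolding ij by blast
      then have "z [^] (- i) \<otimes> d x = d x \<otimes> z [^] (- i)" using commute_pow[OF dc[OF x]] by simp
      then have "x = d x \<otimes> z [^] (- i) \<otimes> z [^] (- j)" using x_eq by simp
      also have "\<dots> = z [^] (0::int) \<otimes> d x \<otimes> z [^] (- i - j)"
        using dc[OF x] by (simp add: m_assoc int_pow_mult flip: int_pow_mult)
      finally show ?thesis unfolding W_def by blast
    next
      case False
      then show ?thesis using x_eq unfolding W_def by blast
    qed
  qed
  have W_unique: "[j = j'] (mod int p)" if x: "x \<in> carrier G" and W: "W x i j" "W x i' j'" for x i j i' j'
  proof (cases "x \<otimes> z = z \<otimes> x")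
    case True
    then have "d x \<otimes> z [^] j = d x \<otimes> z [^] j'" using W dc[OF x] unfolding W_def by (metis int_pow_0 l_one)
    then show ?thesis using dc[OF x] by (simp add: z_pow_eq_iff)
  next
    case False
    have e: "z [^] i \<otimes> d x \<otimes> z [^] j = z [^] i' \<otimes> d x \<otimes> z [^] j'" using W unfolding W_def by metis
    have n: "d x \<otimes> z \<noteq> z \<otimes> d x"
      using False commute_pow_mult_iff[OF dc[OF x], of i j] W(1) unfolding W_def by metis
    \<comment> \<open>Two expressions for \<open>x\<close> make \<open>d x\<close> conjugate one
      power of \<open>z\<close> to another. If \<open>p\<close> did not divide
      \<open>j' - j\<close>, then \<open>d x\<close> would commute with \<open>z\<close>.\<close>
    have "d x \<otimes> z [^] (j' - j) = z [^] (- i') \<otimes> (z [^] i' \<otimes> d x \<otimes> z [^] j') \<otimes> z [^] (- j)"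
    proof -
      have "z [^] (- i') \<otimes> (z [^] i' \<otimes> d x \<otimes> z [^] j') \<otimes> z [^] (- j) 
        = (z [^] (- i') \<otimes> z [^] i') \<otimes> d x \<otimes> (z [^] j' \<otimes> z [^] (- j))"
        using dc[OF x] by (simp add: m_assoc)
      also have "\<dots> = d x \<otimes> z [^] (j' - j)" using dc[OF x] by (simp flip: int_pow_mult)
      finally show ?thesis by simp
    qed
    also have "\<dots> = z [^] (- i') \<otimes> (z [^] i \<otimes> d x \<otimes> z [^] j) \<otimes> z [^] (- j)" unfolding e ..
    also have "\<dots> = (z [^] (- i') \<otimes> z [^] i) \<otimes> d x \<otimes> (z [^] j \<otimes> z [^] (- j))"
      using dc[OF x] by (simp add: m_assoc)
    also have "\<dots> = z [^] (i - i') \<otimes> d x" using dc[OF x] by (simp flip: int_pow_mult)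
    finally have "int p dvd j' - j" using commute_if_pow_normalizes[OF dc[OF x]] n by blast
    then show ?thesis by (simp add: cong_iff_dvd_diff dvd_diff_commute)
  qed
  define c where "c x = (SOME j. \<exists>i. W x i j)" for x
  have c: "\<exists>i. W x i (c x)" if "x \<in> carrier G" for x
    unfolding c_def using W_ex[OF that] by (rule someI_ex)
  show ?thesis
  proof (rule that)
    fix x and j :: int assume x: "x \<in> carrier G"
    obtain i where i: "W x i (c x)" using c[OF x] by blast
    have dx: "d (x \<otimes> z [^] j) = d x" using d_eq[OF x, of 0 j] x by simp
    have cm: "(x \<otimes> z [^] j) \<otimes> z = z \<otimes> (x \<otimes> z [^] j) \<longleftrightarrow> x \<otimes> z = z \<otimes> x"
      using commute_pow_mult_iff[OF x, of 0 j] x by simp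
    have "x \<otimes> z [^] j = z [^] i \<otimes> d x \<otimes> z [^] (c x) \<otimes> z [^] j" using i unfolding W_def by simp
    also have "\<dots> = z [^] i \<otimes> d x \<otimes> z [^] (c x + j)" using dc[OF x] by (simp add: m_assoc int_pow_mult)
    finally have "W (x \<otimes> z [^] j) i (c x + j)" using i unfolding W_def dx cm by blast
    then show "[c (x \<otimes> z [^] j) = c x + j] (mod int p)" using W_unique c x by (meson m_closed int_pow_closed z)
  next
    fix x assume x: "x \<in> carrier G" and n: "x \<otimes> z \<noteq> z \<otimes> x"
    obtain i where i: "W x i (c x)" using c[OF x] by blast
    have dx: "d (z \<otimes> x) = d x" using d_eq[OF x, of 1 0] x by simp
    have cm: "(z \<otimes> x) \<otimes> z \<noteq> z \<otimes> (z \<otimes> x)"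
      using commute_pow_mult_iff[OF x, of 1 0] x n by simp
    have "z \<otimes> x = z \<otimes> (z [^] i \<otimes> d x \<otimes> z [^] (c x))" using i unfolding W_def by simp
    \<comment> \<open>Left multiplication by \<open>z\<close> is absorbed by the left exponent,
      which is unrestricted outside the centralizer, so the coordinate does not change.\<close>
    also have "\<dots> = z [^] (1 + i) \<otimes> d x \<otimes> z [^] (c x)" using dc[OF x] by (simp add: m_assoc int_pow_mult)
    finally have "W (z \<otimes> x) (1 + i) (c x)" using cm unfolding W_def dx by blast
    then show "[c (z \<otimes> x) = c x] (mod int p)" using W_unique c x by (meson m_closed z)
  qed
qed

text \<open>Along a coset of the powers of \<open>z\<close>, \<open>f\<close> runs through an
  arithmetic progression whose step \<open>s\<close> is invertible modulo \<open>p\<close>; so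
  exactly one of the \<open>p\<close> elements of the coset is a zero. This serves for
  \<open>c\<close> on the centralizer of \<open>z\<close> and for the transfer on the whole
  group.\<close>

lemma card_eq_prime_mult_zeros:
  fixes f :: "'a \<Rightarrow> int"
  assumes B: "B \<subseteq> carrier G" "\<And>x i. x \<in> B \<Longrightarrow> x \<otimes> z [^] (i::int) \<in> B"
    and f: "\<And>x i. x \<in> B \<Longrightarrow> [f (x \<otimes> z [^] i) = f x + i * s] (mod int p)"
    and s: "\<not> int p dvd s"
  shows "card B = p * card {x \<in> B. int p dvd f x}"
proof -
  let ?A = "{x \<in> B. int p dvd f x}"
  have cop: "coprime s (int p)" using s p by (metis coprime_commute prime_imp_coprime prime_nat_int_transfer)
  have "bij_betw (\<lambda>(x, i). x \<otimes> z [^] i) (?A \<times> {0..<int p}) B"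
    unfolding bij_betw_def
  proof (intro conjI subset_antisym)
    show "inj_on (\<lambda>(x, i). x \<otimes> z [^] i) (?A \<times> {0..<int p})"
    proof (rule inj_onI, clarify)
      fix x y and i j :: int
      assume *: "x \<in> B" "int p dvd f x" "i \<in> {0..<int p}" "y \<in> B" "int p dvd f y"
        "j \<in> {0..<int p}" "x \<otimes> z [^] i = y \<otimes> z [^] j"
      have "[f x + i * s = f y + j * s] (mod int p)"
        using f[of x i] f[of y j] * by (metis cong_sym cong_trans)
      moreover have "[f x = f y] (mod int p)" using * by (simp add: cong_iff_dvd_diff)
      ultimately have "[i * s = j * s] (mod int p)"
        by (metis cong_add_lcancel cong_add_rcancel cong_sym cong_trans)
      then have "[i = j] (mod int p)" using cop by (simp add: cong_mult_rcancel)
      then have "i = j" using * by (auto simp: cong_def)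
      moreover have "x \<in> carrier G" "y \<in> carrier G" using * B by auto
      ultimately show "x = y \<and> i = j" using * by simp
    qed
    show "(\<lambda>(x, i). x \<otimes> z [^] i) ` (?A \<times> {0..<int p}) \<subseteq> B" using B by auto
    show "B \<subseteq> (\<lambda>(x, i). x \<otimes> z [^] i) ` (?A \<times> {0..<int p})"
    proof
      fix y assume y: "y \<in> B"
      obtain t where t: "[s * t = 1] (mod int p)" using cop cong_solve_coprime_int by blast
      \<comment> \<open>As \<open>t\<close> inverts \<open>s\<close>, this exponent solves
        \<open>i * s = f y\<close> modulo \<open>p\<close>; moving \<open>y\<close> back by it
        reaches the zero in its coset.\<close>
      define i where "i = (t * f y) mod int p"
      have "[i = t * f y] (mod int p)" unfolding i_def by (simp add: cong_def)
      then have "[i * s = t * f y * s] (mod int p)" by (rule cong_scalar_right)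
      also have "t * f y * s = f y * (s * t)" by simp
      also have "[\<dots> = f y * 1] (mod int p)" using t by (rule cong_scalar_left)
      finally have is_: "[i * s = f y] (mod int p)" by simp
      have "[f (y \<otimes> z [^] (- i)) = f y + (- i) * s] (mod int p)" using f y by blast
      also have "[f y + (- i) * s = 0] (mod int p)" 
        using is_ by (simp add: cong_iff_dvd_diff dvd_diff_commute)
      finally have "int p dvd f (y \<otimes> z [^] (- i))" by (simp add: cong_0_iff)
      then have "y \<otimes> z [^] (- i) \<in> ?A" using B y by blast
      moreover have "i \<in> {0..<int p}" unfolding i_def using prime_gt_0_nat[OF p] by simp
      moreover have "y = y \<otimes> z [^] (- i) \<otimes> z [^] i" 
      proof -
        have "y \<in> carrier G" using B y by blast
        then have "y \<otimes> z [^] (- i) \<otimes> z [^] i = y \<otimes> (z [^] (- i) \<otimes> z [^] i)" by (simp add: m_assoc)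
        then show ?thesis using \<open>y \<in> carrier G\<close> by (simp flip: int_pow_mult)
      qed
      ultimately show "y \<in> (\<lambda>(x, i). x \<otimes> z [^] i) ` (?A \<times> {0..<int p})" by force
    qed
  qed
  then have "card (?A \<times> {0..<int p}) = card B" by (rule bij_betw_same_card)
  then show ?thesis by (simp add: card_cartesian_product mult.commute)
qed

text \<open>\<open>V\<close> is the exponent of the transfer into the subgroup generated by
  \<open>z\<close>. At \<open>z\<close> it counts the transversal elements in the centralizer of
  \<open>z\<close>; their number is the index of that subgroup in the centralizer, which divides
  \<open>m\<close> and so is prime to \<open>p\<close>.\<close>

lemma transfer_map:
  obtains V :: "'a \<Rightarrow> int" where
    "\<And>g h. \<lbrakk>g \<in> carrier G; h \<in> carrier G\<rbrakk> \<Longrightarrow> [V (g \<otimes> h) = V g + V h] (mod int p)"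
    "\<not> int p dvd V z"
proof -
  obtain c :: "'a \<Rightarrow> int" where
    c: "\<And>x j. x \<in> carrier G \<Longrightarrow> [c (x \<otimes> z [^] j) = c x + j] (mod int p)"
    and c_left: "\<And>x. \<lbrakk>x \<in> carrier G; x \<otimes> z \<noteq> z \<otimes> x\<rbrakk> \<Longrightarrow> [c (z \<otimes> x) = c x] (mod int p)"
    by (rule coset_coordinate) blast
  define R where "R = {x \<in> carrier G. int p dvd c x}"
  have R: "finite R" "R \<subseteq> carrier G" unfolding R_def using finite_carrier by auto
  define V where "V g = (\<Sum>x\<in>R. c (g \<otimes> x))" for g
  \<comment> \<open>\<open>r y\<close> is the element of the transversal \<open>R\<close> in the
    coset of \<open>y\<close>, and \<open>c y\<close> is the exponent that leads from it back to
    \<open>y\<close>.\<close>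
  define r where "r y = y \<otimes> z [^] (- c y)" for y
  have r: "r y \<in> R" if "y \<in> carrier G" for y
    using c[OF that, of "- c y"] that unfolding R_def r_def by (simp add: cong_0_iff)
  have r_mult: "r y \<otimes> z [^] c y = y" if "y \<in> carrier G" for y
    unfolding r_def using that by (simp add: m_assoc flip: int_pow_mult)
  have hom: "[V (g \<otimes> h) = V g + V h] (mod int p)" if g: "g \<in> carrier G" and h: "h \<in> carrier G" for g h
  proof -
    have inj: "inj_on (\<lambda>x. r (h \<otimes> x)) R"
    proof (rule inj_onI)
      fix x y assume xy: "x \<in> R" "y \<in> R" "r (h \<otimes> x) = r (h \<otimes> y)"
      then have xyc: "x \<in> carrier G" "y \<in> carrier G" using R by auto
      define a where "a = c (h \<otimes> y) - c (h \<otimes> x)"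
      have "h \<otimes> (x \<otimes> z [^] a) = r (h \<otimes> x) \<otimes> z [^] c (h \<otimes> x) \<otimes> z [^] a"
        using xyc h by (simp add: r_mult m_assoc)
      also have "\<dots> = r (h \<otimes> y) \<otimes> z [^] (c (h \<otimes> x) + a)"
        using xyc h unfolding xy(3) by (simp add: r_def m_assoc int_pow_mult)
      also have "\<dots> = h \<otimes> y" unfolding a_def using xyc h by (simp add: r_mult)
      finally have y: "y = x \<otimes> z [^] a" using xyc h by simp
      have "[c y = c x + a] (mod int p)" unfolding y using c xyc by blast
      moreover have "[c y = 0] (mod int p)" "[c x = 0] (mod int p)" using xy unfolding R_def by (auto simp: cong_0_iff)
      ultimately have "[a = 0] (mod int p)" 
        by (metis add_0 cong_add_rcancel cong_sym cong_trans)
      then have "z [^] a = z [^] (0::int)" by (simp only: z_pow_eq_iff)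
      then show "x = y" using y xyc by simp
    qed
    have "(\<lambda>x. r (h \<otimes> x)) ` R \<subseteq> R" using r h R by auto
    then have bij: "bij_betw (\<lambda>x. r (h \<otimes> x)) R R" 
      using inj R endo_inj_surj unfolding bij_betw_def by blast
    \<comment> \<open>Splitting \<open>h \<otimes> x\<close> into its representative and a power of
      \<open>z\<close> separates the two contributions; the representatives merely permute
      \<open>R\<close>.\<close>
    have "[V (g \<otimes> h) = (\<Sum>x\<in>R. c (g \<otimes> r (h \<otimes> x)) + c (h \<otimes> x))] (mod int p)"
      unfolding V_def
    proof (rule cong_sum)
      fix x assume "x \<in> R"
      then have x: "x \<in> carrier G" using R by blast
      have "r (h \<otimes> x) \<in> carrier G" using r R h x by blast
      then have "g \<otimes> h \<otimes> x = (g \<otimes> r (h \<otimes> x)) \<otimes> z [^] c (h \<otimes> x)" 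
        using g h x by (simp add: m_assoc r_mult)
      then show "[c (g \<otimes> h \<otimes> x) = c (g \<otimes> r (h \<otimes> x)) + c (h \<otimes> x)] (mod int p)"
        using c[of "g \<otimes> r (h \<otimes> x)" "c (h \<otimes> x)"] g \<open>r (h \<otimes> x) \<in> carrier G\<close> by simp
    qed
    also have "(\<Sum>x\<in>R. c (g \<otimes> r (h \<otimes> x)) + c (h \<otimes> x)) = V g + V h"
      unfolding V_def sum.distrib using sum.reindex_bij_betw[OF bij, of "\<lambda>x. c (g \<otimes> x)"] by simp
    finally show ?thesis .
  qed
  have "\<not> int p dvd V z"
  proof -
    define C where "C = {x \<in> carrier G. x \<otimes> z = z \<otimes> x}"
    have C: "subgroup C G"
    proof (rule subgroupI)
      show "inv x \<in> C" if "x \<in> C" for x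
      proof -
        have x: "x \<in> carrier G" "x \<otimes> z = z \<otimes> x" using that unfolding C_def by auto
        have "inv x \<otimes> z = inv x \<otimes> (z \<otimes> x) \<otimes> inv x" using x(1) by (simp add: m_assoc)
        also have "\<dots> = z \<otimes> inv x" unfolding x(2)[symmetric] using x(1) by (simp flip: m_assoc)
        finally show ?thesis using x unfolding C_def by simp
      qed
      show "x \<otimes> y \<in> C" if "x \<in> C" "y \<in> C" for x y
      proof -
        have x: "x \<in> carrier G" "y \<in> carrier G" "x \<otimes> z = z \<otimes> x" "y \<otimes> z = z \<otimes> y" 
          using that unfolding C_def by auto
        have "x \<otimes> y \<otimes> z = x \<otimes> z \<otimes> y" using x(1,2,4) by (simp add: m_assoc)
        also have "\<dots> = z \<otimes> (x \<otimes> y)" unfolding x(3) using x(1,2) by (simp add: m_assoc)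
        finally show ?thesis using x unfolding C_def by simp
      qed
      have "z \<in> C" unfolding C_def by simp
      then show "C \<noteq> {}" by blast
    qed (auto simp: C_def)
    have "card C = p * card {x \<in> C. int p dvd c x}"
    proof (rule card_eq_prime_mult_zeros[where s = 1])
      show "x \<otimes> z [^] i \<in> C" if "x \<in> C" for x and i :: int
        using that commute_pow_mult_iff[of x 0 i] unfolding C_def by simp
      show "\<not> int p dvd 1" using p prime_gt_1_nat[OF p] by auto
    qed (use c in \<open>auto simp: C_def\<close>)
    moreover have "card C dvd p * m" using lagrange[OF C] order by (metis dvd_triv_right)
    ultimately have "card {x \<in> C. int p dvd c x} dvd m" using p prime_gt_0_nat by auto
    then have not_dvd: "\<not> p dvd card {x \<in> C. int p dvd c x}"
      using p_m p by (metis coprime_common_divisor_nat dvd_refl dvd_trans not_prime_1)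
    \<comment> \<open>For \<open>x\<close> in \<open>R\<close> outside \<open>C\<close>,
      multiplication by \<open>z\<close> keeps the coordinate 0; inside \<open>C\<close> it equals
      \<open>x \<otimes> z\<close> and has coordinate 1.\<close>
    have "[V z = (\<Sum>x\<in>R. if x \<in> C then 1 else 0)] (mod int p)"
      unfolding V_def
    proof (rule cong_sum)
      fix x assume "x \<in> R"
      then have x: "x \<in> carrier G" "[c x = 0] (mod int p)" unfolding R_def by (auto simp: cong_0_iff)
      show "[c (z \<otimes> x) = (if x \<in> C then 1 else 0)] (mod int p)"
      proof (cases "x \<otimes> z = z \<otimes> x")
        case True
        have "[c (z \<otimes> x) = c x + 1] (mod int p)" using c[OF x(1), of 1] True by simp
        also have "[c x + 1 = 0 + 1] (mod int p)" using x(2) by (intro cong_add) auto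
        finally show ?thesis using True x unfolding C_def by simp
      next
        case False
        then show ?thesis using c_left[OF x(1)] x cong_trans unfolding C_def by auto
      qed
    qed
    also have "(\<Sum>x\<in>R. if x \<in> C then 1 else 0) = int (card (R \<inter> C))"
      using R by (simp add: sum.If_cases Int_def)
    also have "R \<inter> C = {x \<in> C. int p dvd c x}" unfolding R_def C_def by auto
    finally show ?thesis using not_dvd by (simp add: cong_dvd_iff)
  qed
  then show ?thesis using that hom by blast
qed

text \<open>The set is the kernel of \<open>V\<close> modulo \<open>p\<close>, of index
  \<open>p\<close> because \<open>V z\<close> is invertible. Elements with
  \<open>x [^] m = \<one>\<close> lie in the kernel since \<open>p\<close> is prime to
  \<open>m\<close>; conversely, the kernel has order \<open>m\<close>. The last claim holds because
  any element outside the kernel generates the quotient.\<close>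

lemma normal_complement:
  shows "subgroup {x \<in> carrier G. x [^] m = \<one>} G"
    and "card {x \<in> carrier G. x [^] m = \<one>} = m"
    and "\<lbrakk>x \<in> carrier G; y \<in> carrier G; x [^] m \<noteq> \<one>\<rbrakk> \<Longrightarrow> \<exists>k::nat. (y \<otimes> x [^] k) [^] m = \<one>"
proof -
  obtain V :: "'a \<Rightarrow> int" where
    V: "\<And>g h. \<lbrakk>g \<in> carrier G; h \<in> carrier G\<rbrakk> \<Longrightarrow> [V (g \<otimes> h) = V g + V h] (mod int p)"
    and Vz: "\<not> int p dvd V z"
    by (rule transfer_map) blast
  have V1: "[V \<one> = 0] (mod int p)" 
    using V[of \<one> \<one>] by (simp add: cong_iff_dvd_diff)
  have V_pow: "[V (x [^] n) = int n * V x] (mod int p)" if x: "x \<in> carrier G" for x and n :: nat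
  proof (induction n)
    case (Suc n)
    have "[V (x [^] Suc n) = V (x [^] n) + V x] (mod int p)" using V x by simp
    also have "[V (x [^] n) + V x = int n * V x + V x] (mod int p)" using Suc by (intro cong_add) auto
    finally show ?case by (simp add: algebra_simps)
  qed (use V1 in simp)
  define M where "M = {x \<in> carrier G. int p dvd V x}"
  have M: "subgroup M G"
  proof (rule subgroupI)
    show "inv x \<in> M" if "x \<in> M" for x
    proof -
      have x: "x \<in> carrier G" "int p dvd V x" using that unfolding M_def by auto
      have "[V \<one> = V x + V (inv x)] (mod int p)" using V[of x "inv x"] x by simp
      then have "[V x + V (inv x) = 0] (mod int p)" using V1 cong_sym cong_trans by blast
      then show ?thesis using x unfolding M_def by (simp add: cong_0_iff dvd_add_right_iff)
    qed
    show "x \<otimes> y \<in> M" if "x \<in> M" "y \<in> M" for x y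
      using that V[of x y] unfolding M_def by (auto simp: cong_dvd_iff)
    show "M \<noteq> {}" using V1 unfolding M_def by (auto simp: cong_0_iff)
  qed (auto simp: M_def)
  have "card (carrier G) = p * card {x \<in> carrier G. int p dvd V x}"
  proof (rule card_eq_prime_mult_zeros[OF _ _ _ Vz])
    \<comment> \<open>\<open>V_pow\<close> speaks of natural exponents, so the integer
      \<open>i\<close> is first replaced by a natural number congruent to it modulo
      \<open>p\<close>.\<close>
    fix x i assume x: "x \<in> carrier G"
    obtain k :: nat where k: "z [^] i = z [^] k" "[int k = i] (mod int p)" 
    proof
      show "[int (nat (i mod int p)) = i] (mod int p)" using prime_gt_0_nat[OF p] by simp
      then show "z [^] i = z [^] nat (i mod int p)" by (metis int_pow_int z_pow_eq_iff)
    qed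
    have "[V (x \<otimes> z [^] i) = V x + V (z [^] i)] (mod int p)" using V x by simp
    also have "[V x + V (z [^] i) = V x + int k * V z] (mod int p)" 
      unfolding k(1) using V_pow by (intro cong_add) auto
    also have "[V x + int k * V z = V x + i * V z] (mod int p)"
      using k(2) by (intro cong_add cong_mult) auto
    finally show "[V (x \<otimes> z [^] i) = V x + i * V z] (mod int p)" .
  qed auto
  then have card_M: "card M = m"
    using order p prime_gt_0_nat unfolding M_def order_def by simp
  have M_eq: "{x \<in> carrier G. x [^] m = \<one>} = M"
  proof (intro subset_antisym subsetI)
    fix x assume "x \<in> {x \<in> carrier G. x [^] m = \<one>}"
    then have x: "x \<in> carrier G" "x [^] m = \<one>" by auto
    have "[int m * V x = 0] (mod int p)" using V_pow[OF x(1), of m] V1 x(2) by (metis cong_sym cong_trans)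
    then have "int p dvd int m * V x" by (simp add: cong_0_iff)
    moreover have "coprime (int p) (int m)" using p_m by simp
    ultimately have "int p dvd V x" by (simp add: coprime_dvd_mult_right_iff)
    then show "x \<in> M" using x unfolding M_def by simp
  next
    fix x assume x: "x \<in> M"
    interpret M: group "G\<lparr>carrier := M\<rparr>" by (rule subgroup.subgroup_is_group[OF M group_axioms])
    have "x [^]\<^bsub>G\<lparr>carrier := M\<rparr>\<^esub> m = \<one>"
      using M.pow_order_eq_1[of x] x card_M by (simp add: order_def)
    then show "x \<in> {x \<in> carrier G. x [^] m = \<one>}"
      using x subgroup.mem_carrier[OF M] by (simp flip: nat_pow_consistent)
  qed
  show "subgroup {x \<in> carrier G. x [^] m = \<one>} G" "card {x \<in> carrier G. x [^] m = \<one>} = m"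
    unfolding M_eq by (fact M card_M)+
  assume x: "x \<in> carrier G" "x [^] m \<noteq> \<one>" and y: "y \<in> carrier G"
  then have "\<not> int p dvd V x" using M_eq unfolding M_def by blast
  then have "coprime (V x) (int p)" using p by (metis coprime_commute prime_imp_coprime prime_nat_int_transfer)
  then obtain t where t: "[V x * t = 1] (mod int p)" using cong_solve_coprime_int by blast
  \<comment> \<open>This solves \<open>V y + k * V x = 0\<close> modulo \<open>p\<close>, with
    \<open>t\<close> as the inverse of \<open>V x\<close>.\<close>
  define k where "k = nat ((- (t * V y)) mod int p)"
  have k: "[int k = - (t * V y)] (mod int p)" 
    unfolding k_def using prime_gt_0_nat[OF p] by simp
  have "[V (y \<otimes> x [^] k) = V y + V (x [^] k)] (mod int p)" using V x y by simp
  also have "[V y + V (x [^] k) = V y + int k * V x] (mod int p)" using V_pow x by (intro cong_add) auto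
  also have "[V y + int k * V x = V y + - (t * V y) * V x] (mod int p)" using k by (intro cong_add cong_mult) auto
  also have "V y + - (t * V y) * V x = V y + - V y * (V x * t)" by (simp add: algebra_simps)
  also have "[\<dots> = V y + - V y * 1] (mod int p)" using t by (intro cong_add cong_mult) auto
  finally have "int p dvd V (y \<otimes> x [^] k)" by (simp add: cong_0_iff)
  then have "y \<otimes> x [^] k \<in> M" using x y unfolding M_def by simp
  then show "\<exists>k::nat. (y \<otimes> x [^] k) [^] m = \<one>" using M_eq by blast
qed

end

text \<open>Sylow's theorem gives a subgroup of order \<open>p\<close>, and any nontrivial element
  of it can serve as \<open>z\<close>. Describing the complement by torsion removes \<open>z\<close>
  from the statement and makes invariance under conjugation evident.\<close>

lemma (in group) elements_of_order_dividing_cofactor: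
  assumes p: "prime p" and order: "order G = p * m" and "coprime p m" "coprime (p - 1) m"
  shows "subgroup {x \<in> carrier G. x [^] m = \<one>} G"
    and "card {x \<in> carrier G. x [^] m = \<one>} = m"
    and "\<lbrakk>x \<in> carrier G; y \<in> carrier G; x [^] m \<noteq> \<one>\<rbrakk> \<Longrightarrow> \<exists>k::nat. (y \<otimes> x [^] k) [^] m = \<one>"
proof -
  have "m > 0" using assms by (intro Nat.gr0I) auto
  then have "finite (carrier G)" using order prime_gt_0_nat[OF p] order_gt_0_iff_finite by simp
  then obtain P where P: "subgroup P G" "card P = p"
    using sylow_thm[OF p group_axioms, of 1 m] order by auto
  interpret P: group "G\<lparr>carrier := P\<rparr>" by (rule subgroup.subgroup_is_group[OF P(1) group_axioms])
  have "P \<noteq> {\<one>}" using P(2) prime_gt_1_nat[OF p] by auto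
  then obtain z where z: "z \<in> P" "z \<noteq> \<one>" using subgroup.one_closed[OF P(1)] by blast
  then have zc: "z \<in> carrier G" using subgroup.mem_carrier[OF P(1)] by blast
  have "z [^] p = \<one>"
    using P.pow_order_eq_1[of z] z P(2) by (simp add: order_def flip: nat_pow_consistent)
  then have "ord z dvd p" using pow_eq_id zc by blast
  then have "ord z = p" using p ord_eq_1[OF zc] z(2) by (metis prime_nat_iff)
  then interpret prime_order_element G z p m
    using assms zc by unfold_locales
  show "subgroup {x \<in> carrier G. x [^] m = \<one>} G"
    and "card {x \<in> carrier G. x [^] m = \<one>} = m"
    and "\<lbrakk>x \<in> carrier G; y \<in> carrier G; x [^] m \<noteq> \<one>\<rbrakk> \<Longrightarrow> \<exists>k::nat. (y \<otimes> x [^] k) [^] m = \<one>"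
    by (fact normal_complement)+
qed

text \<open>For the least prime divisor \<open>p\<close> of \<open>n\<close>, a common prime factor
  of \<open>p - 1\<close> and \<open>m\<close> would be a smaller prime divisor of
  \<open>n\<close>.\<close>

lemma squarefree_smallest_prime_factor:
  fixes n :: nat
  assumes "squarefree n" "n \<noteq> 1"
  obtains p m where "prime p" "n = p * m" "coprime p m" "coprime (p - 1) m"
proof -
  define p where "p = (LEAST q. prime q \<and> q dvd n)"
  have "\<exists>q. prime q \<and> q dvd n" using assms(2) prime_factor_nat by blast
  then have p: "prime p" "p dvd n" unfolding p_def by (metis (mono_tags, lifting) LeastI_ex)+
  then obtain m where m: "n = p * m" by blast
  have "\<not> p dvd m"
  proof
    assume "p dvd m"
    then have "p ^ 2 dvd n" unfolding m power2_eq_square by simp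
    then have "p dvd 1" using assms(1) unfolding squarefree_def by blast
    then show False using p(1) by auto
  qed
  then have "coprime p m" using p(1) prime_imp_coprime by blast
  moreover have "coprime (p - 1) m"
  proof (rule ccontr)
    assume "\<not> coprime (p - 1) m"
    then have "gcd (p - 1) m \<noteq> 1" by (metis coprime_iff_gcd_eq_1)
    then obtain q where "prime q" "q dvd gcd (p - 1) m" using prime_factor_nat by blast
    then have q: "prime q" "q dvd p - 1" "q dvd m" by (meson dvd_trans gcd_dvd1 gcd_dvd2)+
    from q(3) have "q dvd n" unfolding m by simp
    then have "p \<le> q" unfolding p_def using q(1) by (intro Least_le) blast
    moreover have "q \<le> p - 1" using q(2) prime_gt_1_nat[OF p(1)] by (intro dvd_imp_le) auto
    ultimately show False using prime_gt_0_nat[OF p(1)] by linarith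
  qed
  ultimately show ?thesis using that p m by blast
qed

subsection \<open>Subgroups of products of groups of square-free order\<close>

context group begin

text \<open>\<open>elements_of_order_dividing_cofactor\<close> is applied inside the given subgroup.
  Its elements killed by \<open>m\<close> are all those of the whole group, so such steps can be
  chained.\<close>

lemma torsion_chain_step:
  assumes M: "subgroup {x \<in> carrier G. x [^] (p * m) = \<one>} G"
    "card {x \<in> carrier G. x [^] (p * m) = \<one>} = p * m"
    and p: "prime p" "coprime p m" "coprime (p - 1) m"
  shows "subgroup {x \<in> carrier G. x [^] m = \<one>} G"
    and "card {x \<in> carrier G. x [^] m = \<one>} = m"
    and "\<lbrakk>x \<in> carrier G; y \<in> carrier G; x [^] (p * m) = \<one>; y [^] (p * m) = \<one>; x [^] m \<noteq> \<one>\<rbrakk>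
      \<Longrightarrow> \<exists>k::nat. (y \<otimes> x [^] k) [^] m = \<one>"
proof -
  let ?M = "{x \<in> carrier G. x [^] (p * m) = \<one>}"
  interpret M: group "G\<lparr>carrier := ?M\<rparr>" by (rule subgroup.subgroup_is_group[OF M(1) group_axioms])
  have sub: "x [^] (p * m) = \<one>" if "x \<in> carrier G" "x [^] m = \<one>" for x
    using that by (metis mult.commute nat_pow_one nat_pow_pow)
  then have eq: "{x \<in> ?M. x [^] m = \<one>} = {x \<in> carrier G. x [^] m = \<one>}" by blast
  have ord_M: "order (G\<lparr>carrier := ?M\<rparr>) = p * m" using M(2) by (simp add: order_def)
  have conv: "{x \<in> carrier (G\<lparr>carrier := ?M\<rparr>). x [^]\<^bsub>G\<lparr>carrier := ?M\<rparr>\<^esub> m = \<one>\<^bsub>G\<lparr>carrier := ?M\<rparr>\<^esub>}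
      = {x \<in> carrier G. x [^] m = \<one>}"
    using eq by (simp flip: nat_pow_consistent)
  note result = M.elements_of_order_dividing_cofactor[OF p(1) ord_M p(2,3), unfolded conv]
  show "subgroup {x \<in> carrier G. x [^] m = \<one>} G"
    using result(1) incl_subgroup[OF M(1)] by blast
  show "card {x \<in> carrier G. x [^] m = \<one>} = m" by (rule result(2))
  show "\<exists>k::nat. (y \<otimes> x [^] k) [^] m = \<one>"
    if "x \<in> carrier G" "y \<in> carrier G" "x [^] (p * m) = \<one>" "y [^] (p * m) = \<one>" "x [^] m \<noteq> \<one>"
    using result(3)[of x y] that by (simp flip: nat_pow_consistent)
qed

text \<open>Taking powers commutes with conjugation, so the torsion subgroup of \<open>K\<close> is
  normal in \<open>K\<close>, and its preimage meets \<open>N\<close> in a normal subgroup of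
  \<open>G\<close>.\<close>

lemma normal_torsion_preimage:
  assumes "group K" and "\<pi> \<in> hom G K" and N: "N \<lhd> G"
    and T: "subgroup {y \<in> carrier K. y [^]\<^bsub>K\<^esub> (m::nat) = \<one>\<^bsub>K\<^esub>} K"
  shows "{x \<in> N. \<pi> x [^]\<^bsub>K\<^esub> m = \<one>\<^bsub>K\<^esub>} \<lhd> G" (is "?M \<lhd> G")
proof -
  interpret \<pi>: group_hom G K \<pi>
    using assms by (simp add: group_hom_def group_hom_axioms_def group_axioms)
  interpret N: normal N G by fact
  let ?T = "{y \<in> carrier K. y [^]\<^bsub>K\<^esub> m = \<one>\<^bsub>K\<^esub>}"
  have M: "?M = {x \<in> N. \<pi> x \<in> ?T}" by auto
  have T1: "\<pi> \<one> \<in> ?T" using subgroup.one_closed[OF T] by simp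
  show ?thesis unfolding M
  proof (rule normal_invI[OF subgroupI])
    show "{x \<in> N. \<pi> x \<in> ?T} \<noteq> {}" using T1 N.one_closed by blast
    show "inv x \<in> {x \<in> N. \<pi> x \<in> ?T}" if "x \<in> {x \<in> N. \<pi> x \<in> ?T}" for x
      using that subgroup.m_inv_closed[OF T, of "\<pi> x"] by auto
    show "x \<otimes> y \<in> {x \<in> N. \<pi> x \<in> ?T}" if "x \<in> {x \<in> N. \<pi> x \<in> ?T}" "y \<in> {x \<in> N. \<pi> x \<in> ?T}" for x y
      using that subgroup.m_closed[OF T, of "\<pi> x" "\<pi> y"] by auto
    fix g x assume g: "g \<in> carrier G" and x: "x \<in> {x \<in> N. \<pi> x \<in> ?T}"
    have conj_pow: "(a \<otimes>\<^bsub>K\<^esub> b \<otimes>\<^bsub>K\<^esub> inv\<^bsub>K\<^esub> a) [^]\<^bsub>K\<^esub> n = a \<otimes>\<^bsub>K\<^esub> b [^]\<^bsub>K\<^esub> n \<otimes>\<^bsub>K\<^esub> inv\<^bsub>K\<^esub> a"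
      if "a \<in> carrier K" "b \<in> carrier K" for a b and n :: nat
      using that by (induction n) (simp_all add: \<pi>.H.m_assoc \<pi>.H.inv_mult_cancel)
    show "g \<otimes> x \<otimes> inv g \<in> {x \<in> N. \<pi> x \<in> ?T}"
      using g x N.inv_op_closed2 by (simp add: conj_pow)
  qed (use N.subset in auto)
qed

text \<open>Each step of the descent removes one prime from \<open>m\<close>. The factor of two
  consecutive preimages embeds in a group of prime order, so no subgroup lies strictly between them,
  and the hypothesis of \<open>sharp_above_step\<close> only concerns the two ends.\<close>

lemma sharp_above_kernel_aux:
  assumes fin: "finite (carrier G)" and K: "group K" and hom: "\<pi> \<in> hom G K" and N: "N \<lhd> G"
  shows "\<lbrakk>squarefree m; subgroup {y \<in> carrier K. y [^]\<^bsub>K\<^esub> m = \<one>\<^bsub>K\<^esub>} K;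
      card {y \<in> carrier K. y [^]\<^bsub>K\<^esub> m = \<one>\<^bsub>K\<^esub>} = m;
      sharp_above G {x \<in> N. \<pi> x [^]\<^bsub>K\<^esub> m = \<one>\<^bsub>K\<^esub>}\<rbrakk>
    \<Longrightarrow> sharp_above G {x \<in> N. \<pi> x = \<one>\<^bsub>K\<^esub>}"
proof (induction m rule: less_induct)
  case (less n)
  interpret \<pi>: group_hom G K \<pi>
    using assms by (simp add: group_hom_def group_hom_axioms_def group_axioms)
  interpret N: normal N G by fact
  show ?case
  proof (cases "n = 1")
    case True
    have "{x \<in> N. \<pi> x [^]\<^bsub>K\<^esub> n = \<one>\<^bsub>K\<^esub>} = {x \<in> N. \<pi> x = \<one>\<^bsub>K\<^esub>}" unfolding True by auto
    then show ?thesis using less.prems(4) by simp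
  next
    case False
    obtain p m where p: "prime p" "coprime p m" "coprime (p - 1) m" and n: "n = p * m"
      using squarefree_smallest_prime_factor[OF less.prems(1) False] by blast
    note step = \<pi>.H.torsion_chain_step[OF less.prems(2,3)[unfolded n] p]
    have "squarefree m" using less.prems(1) unfolding n by (rule squarefree_multD)
    then have "m > 0" by (intro Nat.gr0I) auto
    then have "m < n" unfolding n using prime_gt_1_nat[OF p(1)] by simp
    let ?N = "{x \<in> N. \<pi> x [^]\<^bsub>K\<^esub> n = \<one>\<^bsub>K\<^esub>}" and ?M = "{x \<in> N. \<pi> x [^]\<^bsub>K\<^esub> m = \<one>\<^bsub>K\<^esub>}"
    have NN: "?N \<lhd> G" by (rule normal_torsion_preimage[OF K hom N less.prems(2)])
    have NM: "?M \<lhd> G" by (rule normal_torsion_preimage[OF K hom N step(1)])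
    have MN: "?M \<subseteq> ?N"
    proof
      fix x assume "x \<in> ?M"
      then have x: "x \<in> N" "\<pi> x [^]\<^bsub>K\<^esub> m = \<one>\<^bsub>K\<^esub>" by auto
      then have "\<pi> x [^]\<^bsub>K\<^esub> (m * p) = \<one>\<^bsub>K\<^esub>" by (simp flip: \<pi>.H.nat_pow_pow)
      then show "x \<in> ?N" using x unfolding n by (simp add: mult.commute)
    qed
    have "sharp_above G ?M"
    proof (rule sharp_above_step[OF fin NN less.prems(4) normal_imp_subgroup[OF NM] MN])
      fix L assume L: "subgroup L G" "?M \<subseteq> L" "L \<subseteq> ?N"
      interpret L: subgroup L G by fact
      have "L = ?M \<or> L = ?N"
      proof (rule disjCI)
        assume "L \<noteq> ?N"
        show "L = ?M"
        proof (rule ccontr)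
          assume "L \<noteq> ?M"
          then obtain x where x: "x \<in> L" "\<pi> x [^]\<^bsub>K\<^esub> m \<noteq> \<one>\<^bsub>K\<^esub>" using L by blast
          \<comment> \<open>Any \<open>y\<close> in \<open>?N\<close> is brought into
            \<open>?M\<close>, hence into \<open>L\<close>, by a power of the element
            \<open>x\<close> of \<open>L\<close>; cancelling that power leaves \<open>y\<close> in
            \<open>L\<close>.\<close>
          have "?N \<subseteq> L"
          proof
            fix y assume y: "y \<in> ?N"
            then have yc: "y \<in> carrier G" and xc: "x \<in> carrier G" using x by auto
            have xN: "x \<in> ?N" using x L by blast
            obtain k :: nat where k: "(\<pi> y \<otimes>\<^bsub>K\<^esub> \<pi> x [^]\<^bsub>K\<^esub> k) [^]\<^bsub>K\<^esub> m = \<one>\<^bsub>K\<^esub>"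
              using step(3)[of "\<pi> x" "\<pi> y"] x(2) xN y yc xc unfolding n by auto
            have xk: "x [^] k \<in> L" using x(1) by (induction k) auto
            have "x [^] k \<in> N" using xk L by blast
            then have "y \<otimes> x [^] k \<in> N" using y by blast
            then have "y \<otimes> x [^] k \<in> ?M" using k xc yc by (simp add: \<pi>.hom_nat_pow)
            then have "y \<otimes> x [^] k \<in> L" using L by blast
            then have "y \<otimes> x [^] k \<otimes> inv (x [^] k) \<in> L" using xk by blast
            then show "y \<in> L" using yc xc by (simp add: m_assoc)
          qed
          then show False using L \<open>L \<noteq> ?N\<close> by blast
        qed
      qed
      then show "L \<lhd> G" using NN NM by metis
    qed
    then show ?thesis using less.IH[OF \<open>m < n\<close> \<open>squarefree m\<close> step(1,2)] by blast
  qed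
qed

text \<open>The descent starts at exponent \<open>order K\<close>, where the torsion condition holds
  for every element, and ends at exponent 1, where it defines the kernel.\<close>

lemma sharp_above_kernel:
  assumes fin: "finite (carrier G)" and K: "group K" and sq: "squarefree (order K)"
    and hom: "\<pi> \<in> hom G K" and N: "N \<lhd> G" and sN: "sharp_above G N"
  shows "{x \<in> N. \<pi> x = \<one>\<^bsub>K\<^esub>} \<lhd> G" and "sharp_above G {x \<in> N. \<pi> x = \<one>\<^bsub>K\<^esub>}"
proof -
  interpret \<pi>: group_hom G K \<pi>
    using assms by (simp add: group_hom_def group_hom_axioms_def group_axioms)
  interpret N: normal N G by fact
  have T: "{y \<in> carrier K. y [^]\<^bsub>K\<^esub> order K = \<one>\<^bsub>K\<^esub>} = carrier K"
    using \<pi>.H.pow_order_eq_1 by blast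
  have eq: "{x \<in> N. \<pi> x [^]\<^bsub>K\<^esub> order K = \<one>\<^bsub>K\<^esub>} = N"
    using \<pi>.H.pow_order_eq_1 by auto
  show "sharp_above G {x \<in> N. \<pi> x = \<one>\<^bsub>K\<^esub>}"
    by (rule sharp_above_kernel_aux[OF fin K hom N sq])
      (simp_all add: T eq sN \<pi>.H.subgroup_self flip: order_def)
  have T1: "{y \<in> carrier K. y [^]\<^bsub>K\<^esub> (1::nat) = \<one>\<^bsub>K\<^esub>} = {\<one>\<^bsub>K\<^esub>}" by auto
  have eq1: "{x \<in> N. \<pi> x [^]\<^bsub>K\<^esub> (1::nat) = \<one>\<^bsub>K\<^esub>} = {x \<in> N. \<pi> x = \<one>\<^bsub>K\<^esub>}" by auto
  show "{x \<in> N. \<pi> x = \<one>\<^bsub>K\<^esub>} \<lhd> G"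
    using normal_torsion_preimage[OF K hom N, of 1] unfolding T1 eq1 by (simp add: \<pi>.H.triv_subgroup)
qed

text \<open>The coordinates are made trivial one at a time, each by
  \<open>sharp_above_kernel\<close> within the subgroup reached so far. Injectivity of
  \<open>f\<close> makes the last subgroup trivial.\<close>

lemma sharp_above_one_if_embeds_in_squarefree_product:
  assumes fin: "finite (carrier G)" and "finite I"
    and K: "\<And>i. i \<in> I \<Longrightarrow> group (K i)" "\<And>i. i \<in> I \<Longrightarrow> squarefree (order (K i))"
    and f: "f \<in> hom G (product_group I K)" "inj_on f (carrier G)"
  shows "sharp_above G {\<one>}"
proof -
  interpret f: group_hom G "product_group I K" f
    using f K by (simp add: group_hom_def group_hom_axioms_def group_axioms)
  have proj: "(\<lambda>x. f x i) \<in> hom G (K i)" if "i \<in> I" for i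
  proof (rule homI)
    show "f x i \<in> carrier (K i)" if "x \<in> carrier G" for x
      using f.hom_closed[OF that] \<open>i \<in> I\<close> by auto
    show "f (x \<otimes> y) i = f x i \<otimes>\<^bsub>K i\<^esub> f y i" if "x \<in> carrier G" "y \<in> carrier G" for x y
      using f.hom_mult[OF that] \<open>i \<in> I\<close> by simp
  qed
  have *: "{x \<in> carrier G. \<forall>i\<in>J. f x i = \<one>\<^bsub>K i\<^esub>} \<lhd> G \<and>
      sharp_above G {x \<in> carrier G. \<forall>i\<in>J. f x i = \<one>\<^bsub>K i\<^esub>}" if "finite J" "J \<subseteq> I" for J
    using that
  proof (induction J rule: finite_induct)
    case empty
    have "carrier G \<lhd> G" by (rule normal_invI[OF subgroup_self]) auto
    then show ?case using sharp_above_carrier[OF fin] by simp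
  next
    case (insert j J)
    let ?N = "{x \<in> carrier G. \<forall>i\<in>J. f x i = \<one>\<^bsub>K i\<^esub>}"
    have "{x \<in> carrier G. \<forall>i\<in>insert j J. f x i = \<one>\<^bsub>K i\<^esub>} = {x \<in> ?N. f x j = \<one>\<^bsub>K j\<^esub>}" by blast
    then show ?case
      using sharp_above_kernel[OF fin K(1) K(2) proj, of j ?N] insert by auto
  qed
  have "{x \<in> carrier G. \<forall>i\<in>I. f x i = \<one>\<^bsub>K i\<^esub>} = {\<one>}"
  proof (intro subset_antisym subsetI)
    fix x assume "x \<in> {x \<in> carrier G. \<forall>i\<in>I. f x i = \<one>\<^bsub>K i\<^esub>}"
    then have x: "x \<in> carrier G" "\<And>i. i \<in> I \<Longrightarrow> f x i = \<one>\<^bsub>K i\<^esub>" by auto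
    \<comment> \<open>Elements of the product are extensional functions, so agreement on
      \<open>I\<close> is equality.\<close>
    have fx: "f x = f \<one>"
      using f.hom_closed[OF x(1)] x(2) by (simp add: PiE_def extensional_def fun_eq_iff)
    then show "x \<in> {\<one>}" using inj_onD[OF f(2) fx x(1) one_closed] by simp
  qed auto
  then show ?thesis using *[OF \<open>finite I\<close> order_refl] by simp
qed

end

theorem theorem1:
  fixes G :: "('a, 'm) monoid_scheme"
  assumes "group G" and "finite (carrier G)"
    and "nilpotent_group G \<or>
      (\<exists>(I :: 'i set) (K :: 'i \<Rightarrow> 'b monoid) H.
         finite I \<and>
         (\<forall>i\<in>I. group (K i) \<and> finite (carrier (K i)) \<and> squarefree (order (K i))) \<and>
         subgroup H (product_group I K) \<and>
         G \<cong> (product_group I K)\<lparr>carrier := H\<rparr>)"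
  shows "weak_EKR_group TYPE('x) G"
proof -
  interpret group G by fact
  have "sharp_above G {\<one>\<^bsub>G\<^esub>}"
    using assms(3)
  proof
    assume "nilpotent_group G"
    then obtain n where "lower_central_series G n = {\<one>\<^bsub>G\<^esub>}" unfolding nilpotent_group_def by blast
    then show ?thesis using lower_central_series_normal_sharp_above[OF assms(2), of n] by simp
  next
    assume "\<exists>(I :: 'i set) (K :: 'i \<Rightarrow> 'b monoid) H.
         finite I \<and>
         (\<forall>i\<in>I. group (K i) \<and> finite (carrier (K i)) \<and> squarefree (order (K i))) \<and>
         subgroup H (product_group I K) \<and>
         G \<cong> (product_group I K)\<lparr>carrier := H\<rparr>"
    then obtain I :: "'i set" and K :: "'i \<Rightarrow> 'b monoid" and H f where
      I: "finite I" "\<And>i. i \<in> I \<Longrightarrow> group (K i)" "\<And>i. i \<in> I \<Longrightarrow> squarefree (order (K i))"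
      and H: "subgroup H (product_group I K)" and f: "f \<in> iso G ((product_group I K)\<lparr>carrier := H\<rparr>)"
      unfolding is_iso_def by blast
    have "f \<in> hom G (product_group I K)" "inj_on f (carrier G)"
      using f subgroup.subset[OF H] unfolding iso_def hom_def bij_betw_def by auto
    then show ?thesis
      using sharp_above_one_if_embeds_in_squarefree_product[OF assms(2) I(1)] I(2,3) by blast
  qed
  then show ?thesis by (rule weak_EKR_group_if_sharp_above_one[OF assms(2)])
qed

end
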